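(* Let $X$ be a nonempty topological space and let $S$ be a nonempty semigroup (under composition) of continuous injective maps from $X$ to $X$ such that (Ore condition) for any $f,g\in S$ there exist $f',g'\in S$ with $f'g=g'f$, and (right cancellation) if $f_1g=f_2g$ with $f_1,f_2,g\in S$, then $f_1=f_2$. Let $\mathcal{B}=\mathcal{B}(X,S)$ be the space of pseudoquotients with the topology defined in the context, and let $G$ be the group of bijections of $\mathcal{B}$ extending $S$, i.e. the group under composition generated by the bijections $\tilde g$, $g\in S$, defined in the context. Then every element of $G$ is a homeomorphism of $\mathcal{B}$ onto $\mathcal{B}$.
   Context: Write $fx$ for $f(x)$ and $fg$ for the composition ($(fg)x=f(gx)$). On $X\times S$ define $(x,f)\sim(y,g)$ if there exist $f',g'\in S$ such that $f'g=g'f$ and $f'y=g'x$. Under the Ore condition this is an equivalence relation. The space of pseudoquotients is $\mathcal{B}(X,S)=(X\times S)/\sim$, and the class of $(x,f)$ is denoted $\frac{x}{f}$. For $g\in S$, the map $\tilde g:\mathcal{B}\to\mathcal{B}$ is defined by $\tilde g\left(\frac{x}{f}\right)=\frac{g'x}{f'}$, where $f',g'\in S$ are any elements with $f'g=g'f$ (under the stated hypotheses this is well defined and a bijection). Topology on $\mathcal{B}$: $S$ carries the discrete topology, $X\times S$ the product topology, and $\mathcal{B}=(X\times S)/\sim$ the quotient topology. *)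

theory Defs
  imports "HOL-Analysis.Analysis" "HOL-Algebra.Bij" "HOL-Algebra.Generated_Groups"
begin

definition quotient_topology :: "'a topology \<Rightarrow> ('a \<Rightarrow> 'b) \<Rightarrow> 'b topology" where
  "quotient_topology T p =
     topology (\<lambda>U. U \<subseteq> p ` topspace T \<and> openin T {z \<in> topspace T. p z \<in> U})"

lemma openin_quotient_topology:
  "openin (quotient_topology T p) U \<longleftrightarrow>
     U \<subseteq> p ` topspace T \<and> openin T {z \<in> topspace T. p z \<in> U}"
proof -
  have "istopology (\<lambda>U. U \<subseteq> p ` topspace T \<and> openin T {z \<in> topspace T. p z \<in> U})"
    unfolding istopology_def
  proof (intro conjI allI impI)
    fix A B
    assume A: "A \<subseteq> p ` topspace T \<and> openin T {z \<in> topspace T. p z \<in> A}"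
      and B: "B \<subseteq> p ` topspace T \<and> openin T {z \<in> topspace T. p z \<in> B}"
    show "A \<inter> B \<subseteq> p ` topspace T" using A by blast
    have "{z \<in> topspace T. p z \<in> A \<inter> B} =
        {z \<in> topspace T. p z \<in> A} \<inter> {z \<in> topspace T. p z \<in> B}" by blast
    then show "openin T {z \<in> topspace T. p z \<in> A \<inter> B}" using A B by auto
  next
    fix K
    assume K: "\<forall>A\<in>K. A \<subseteq> p ` topspace T \<and> openin T {z \<in> topspace T. p z \<in> A}"
    show "\<Union>K \<subseteq> p ` topspace T" using K by blast
    have "{z \<in> topspace T. p z \<in> \<Union>K} = (\<Union>A\<in>K. {z \<in> topspace T. p z \<in> A})" by blast
    then show "openin T {z \<in> topspace T. p z \<in> \<Union>K}" using K by auto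
  qed
  then show ?thesis
    by (simp add: quotient_topology_def topology_inverse')
qed

lemma topspace_quotient_topology [simp]:
  "topspace (quotient_topology T p) = p ` topspace T"
proof (rule antisym)
  show "topspace (quotient_topology T p) \<subseteq> p ` topspace T"
    using openin_quotient_topology[of T p "topspace (quotient_topology T p)"] by simp
  have "{z \<in> topspace T. p z \<in> p ` topspace T} = topspace T" by blast
  then have "openin (quotient_topology T p) (p ` topspace T)"
    by (simp add: openin_quotient_topology)
  then show "p ` topspace T \<subseteq> topspace (quotient_topology T p)"
    by (rule openin_subset)
qed

lemma quotient_map_quotient_topology: "quotient_map T (quotient_topology T p) p"
  unfolding quotient_map_def by (simp add: openin_quotient_topology)

text \<open>
  A self-map of the space \<open>X\<close> is represented by its extension to the ambient type that is
  \<^term>\<open>undefined\<close> outside \<^term>\<open>topspace X\<close>, so that equality of HOL functions is equality of maps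
  on the space. Composition is \<^term>\<open>compose (topspace X)\<close>, which preserves this normalisation.
\<close>

definition pq_rel :: "'a topology \<Rightarrow> ('a \<Rightarrow> 'a) set \<Rightarrow> (('a \<times> ('a \<Rightarrow> 'a)) \<times> ('a \<times> ('a \<Rightarrow> 'a))) set"
  where "pq_rel X S =
    {((x, f), (y, g)). x \<in> topspace X \<and> f \<in> S \<and> y \<in> topspace X \<and> g \<in> S \<and>
       (\<exists>f'\<in>S. \<exists>g'\<in>S. compose (topspace X) f' g = compose (topspace X) g' f \<and> f' y = g' x)}"

definition pq_class :: "'a topology \<Rightarrow> ('a \<Rightarrow> 'a) set \<Rightarrow> 'a \<Rightarrow> ('a \<Rightarrow> 'a) \<Rightarrow> ('a \<times> ('a \<Rightarrow> 'a)) set"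
  where "pq_class X S x f = pq_rel X S `` {(x, f)}"

definition pq_space :: "'a topology \<Rightarrow> ('a \<Rightarrow> 'a) set \<Rightarrow> ('a \<times> ('a \<Rightarrow> 'a)) set set"
  where "pq_space X S = (topspace X \<times> S) // pq_rel X S"

definition pq_topology :: "'a topology \<Rightarrow> ('a \<Rightarrow> 'a) set \<Rightarrow> ('a \<times> ('a \<Rightarrow> 'a)) set topology"
  where "pq_topology X S =
    quotient_topology (prod_topology X (discrete_topology S)) (\<lambda>(x, f). pq_class X S x f)"

lemma topspace_pq_topology: "topspace (pq_topology X S) = pq_space X S"
  by (auto simp: pq_topology_def pq_space_def pq_class_def quotient_def)

text \<open>
  The map \<open>x/f \<mapsto> (g' x)/f'\<close> with \<open>f' g = g' f\<close>. The description is unique because under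
  the Ore and right cancellation conditions the value depends neither on the representative
  \<open>(x, f)\<close> nor on the choice of \<open>f', g'\<close>.
\<close>

definition pq_extend ::
    "'a topology \<Rightarrow> ('a \<Rightarrow> 'a) set \<Rightarrow> ('a \<Rightarrow> 'a) \<Rightarrow> ('a \<times> ('a \<Rightarrow> 'a)) set \<Rightarrow> ('a \<times> ('a \<Rightarrow> 'a)) set"
  where "pq_extend X S g = (\<lambda>c\<in>pq_space X S. THE d.
    \<exists>x\<in>topspace X. \<exists>f\<in>S. \<exists>f'\<in>S. \<exists>g'\<in>S.
      c = pq_class X S x f \<and> compose (topspace X) f' g = compose (topspace X) g' f \<and>
      d = pq_class X S (g' x) f')"

definition pq_group ::
    "'a topology \<Rightarrow> ('a \<Rightarrow> 'a) set \<Rightarrow> (('a \<times> ('a \<Rightarrow> 'a)) set \<Rightarrow> ('a \<times> ('a \<Rightarrow> 'a)) set) set"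
  where "pq_group X S = generate (BijGroup (pq_space X S)) (pq_extend X S ` S)"

end

(*
  Read x/f as the value of the inverse of f at x. On X x S the map extending g is
  (x, f) |-> (g' x, f') with f' g = g' f, and its inverse is (x, f) |-> (x, f g). For fixed f both
  are continuous in x; as S is discrete, they are continuous on X x S, hence descend to continuous
  maps of the quotient. So the generators are homeomorphisms, and these form a group.
*)
theory Submission
  imports Defs
begin

text \<open>Points of the discrete factor are open, so a preimage under \<open>F\<close> is a union
  of open sets, one in each slice \<open>X \<times> {s}\<close>.\<close>

lemma continuous_map_from_prod_discrete:
  assumes "\<And>s. s \<in> S \<Longrightarrow> continuous_map X Z (\<lambda>x. F (x, s))"
  shows "continuous_map (prod_topology X (discrete_topology S)) Z F"
proof -
  have into: "F (x, s) \<in> topspace Z" if "x \<in> topspace X" "s \<in> S" for x s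
    using continuous_map_funspace[OF assms[OF that(2)]] that(1) by blast
  have "openin (prod_topology X (discrete_topology S)) {z \<in> topspace X \<times> S. F z \<in> U}"
    if U: "openin Z U" for U
  proof -
    let ?V = "\<lambda>s. {x \<in> topspace X. F (x, s) \<in> U}"
    have "{z \<in> topspace X \<times> S. F z \<in> U} = (\<Union>s\<in>S. ?V s \<times> {s})"
      by auto
    moreover have "openin (prod_topology X (discrete_topology S)) (?V s \<times> {s})" if "s \<in> S" for s
      using openin_continuous_map_preimage[OF assms[OF that] U] that
      by (simp add: openin_prod_Times_iff)
    ultimately show ?thesis by auto
  qed
  then show ?thesis
    using into by (auto simp: continuous_map_def)
qed

section \<open>Fractions under the Ore condition\<close>

locale pseudoquotients =
  fixes X :: "'a topology" and S :: "('a \<Rightarrow> 'a) set"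
  assumes continuous: "f \<in> S \<Longrightarrow> continuous_map X X f"
    and injective: "f \<in> S \<Longrightarrow> inj_on f (topspace X)"
    and comp_closed: "f \<in> S \<Longrightarrow> g \<in> S \<Longrightarrow> compose (topspace X) f g \<in> S"
    and Ore: "f \<in> S \<Longrightarrow> g \<in> S \<Longrightarrow>
      \<exists>f'\<in>S. \<exists>g'\<in>S. compose (topspace X) f' g = compose (topspace X) g' f"
    and right_cancel: "f1 \<in> S \<Longrightarrow> f2 \<in> S \<Longrightarrow> g \<in> S \<Longrightarrow>
      compose (topspace X) f1 g = compose (topspace X) f2 g \<Longrightarrow> f1 = f2"
begin

abbreviation D :: "'a set" where "D \<equiv> topspace X"
abbreviation comp_X :: "('a \<Rightarrow> 'a) \<Rightarrow> ('a \<Rightarrow> 'a) \<Rightarrow> ('a \<Rightarrow> 'a)" (infixl "\<star>" 70)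
  where "f \<star> g \<equiv> compose D f g"
abbreviation frac :: "'a \<Rightarrow> ('a \<Rightarrow> 'a) \<Rightarrow> ('a \<times> ('a \<Rightarrow> 'a)) set"
  where "frac x f \<equiv> pq_class X S x f"

lemma maps_to: "f \<in> S \<Longrightarrow> x \<in> D \<Longrightarrow> f x \<in> D"
  using continuous_map_funspace[OF continuous] by blast

text \<open>Only the innermost map has to preserve \<open>D\<close>: the truncation of
  \<open>f \<star> g\<close> outside \<open>D\<close> is felt only at values of
  \<open>h\<close>.\<close>

lemma assoc: "h \<in> S \<Longrightarrow> f \<star> (g \<star> h) = f \<star> g \<star> h"
  by (rule compose_assoc[where B = D]) (simp add: maps_to)

lemma comp_fun_cong: "p \<star> f = q \<star> g \<Longrightarrow> x \<in> D \<Longrightarrow> p (f x) = q (g x)"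
  by (drule fun_cong[of _ _ x]) (simp add: compose_eq)

text \<open>Glues two Ore squares that share the map \<open>g\<close>, once \<open>u\<close> and
  \<open>v\<close> have matched the multipliers \<open>p\<close> and \<open>f'\<close> of
  \<open>g\<close>. Every comparison of fractions below uses it.\<close>

lemma comp_eq_trans:
  assumes "u \<star> p = v \<star> f'" "p \<star> g = q \<star> h" "f' \<star> g = g' \<star> f"
    and "f \<in> S" "g \<in> S" "h \<in> S"
  shows "(u \<star> q) \<star> h = (v \<star> g') \<star> f"
proof -
  have "(u \<star> q) \<star> h = u \<star> (p \<star> g)"
    using assms by (simp add: assoc[symmetric])
  also have "\<dots> = v \<star> (f' \<star> g)"
    using assms(1,5) by (simp add: assoc)
  also have "\<dots> = (v \<star> g') \<star> f"
    using assms by (simp add: assoc)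
  finally show ?thesis .
qed

text \<open>Upgrades the existential in \<open>pq_rel\<close> to a universal statement. Right
  cancellation identifies \<open>u \<star> q\<close> with \<open>v \<star> g'\<close>, so
  \<open>u (p y) = v (f' y) = v (g' x) = u (q x)\<close>, and \<open>u\<close> is injective.\<close>

lemma pq_rel_common_multiple:
  assumes rel: "((x, f), (y, g)) \<in> pq_rel X S"
    and S: "p \<in> S" "q \<in> S" and pq: "p \<star> g = q \<star> f"
  shows "p y = q x"
proof -
  from rel obtain f' g' where D: "x \<in> D" "y \<in> D" and fg: "f \<in> S" "g \<in> S"
    and S': "f' \<in> S" "g' \<in> S" and eq: "f' \<star> g = g' \<star> f" "f' y = g' x"
    by (auto simp: pq_rel_def)
  obtain u v where uv: "u \<in> S" "v \<in> S" "u \<star> p = v \<star> f'"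
    using Ore[OF S'(1) S(1)] by blast
  have "(u \<star> q) \<star> f = (v \<star> g') \<star> f"
    using comp_eq_trans[OF uv(3) pq eq(1)] fg by blast
  then have "u \<star> q = v \<star> g'"
    using right_cancel[of "u \<star> q" "v \<star> g'" f] comp_closed S S' fg uv by blast
  then have "u (p y) = u (q x)"
    using comp_fun_cong[OF uv(3) D(2)] comp_fun_cong[OF _ D(1)] eq(2) by metis
  then show ?thesis
    using inj_onD[OF injective[OF uv(1)]] maps_to D S by blast
qed

lemma equiv_pq_rel: "equiv (D \<times> S) (pq_rel X S)"
proof (rule equivI)
  show "pq_rel X S \<subseteq> (D \<times> S) \<times> (D \<times> S)"
    by (auto simp: pq_rel_def)
  show "refl_on (D \<times> S) (pq_rel X S)"
    by (auto simp: refl_on_def pq_rel_def)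
  show "sym (pq_rel X S)"
    unfolding sym_def pq_rel_def by clarsimp (blast intro: sym)
  show "trans (pq_rel X S)"
  proof (rule transI, clarify)
    fix x f y g z h
    assume 1: "((x, f), (y, g)) \<in> pq_rel X S" and 2: "((y, g), (z, h)) \<in> pq_rel X S"
    from 1 obtain f' g' where D1: "x \<in> D" "y \<in> D" "f \<in> S" "g \<in> S" "f' \<in> S" "g' \<in> S"
      and eq1: "f' \<star> g = g' \<star> f" "f' y = g' x"
      by (auto simp: pq_rel_def)
    from 2 obtain a b where D2: "z \<in> D" "h \<in> S" "a \<in> S" "b \<in> S"
      and eq2: "a \<star> h = b \<star> g" "a z = b y"
      by (auto simp: pq_rel_def)
    \<comment> \<open>Both \<open>b\<close> and \<open>f'\<close> multiply the middle denominator
      \<open>g\<close>; matching them makes \<open>u \<star> a\<close> and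
      \<open>v \<star> g'\<close> the witnesses for the outer pair.\<close>
    obtain u v where uv: "u \<in> S" "v \<in> S" "u \<star> b = v \<star> f'"
      using Ore[OF D1(5) D2(4)] by blast
    have "(u \<star> a) \<star> h = (v \<star> g') \<star> f"
      using comp_eq_trans[OF uv(3) eq2(1)[symmetric] eq1(1)] D1 D2 by blast
    moreover have "(u \<star> a) z = (v \<star> g') x"
      using comp_fun_cong[OF uv(3) D1(2)] eq1(2) eq2(2) D1 D2 by (simp add: compose_eq)
    ultimately show "((x, f), (z, h)) \<in> pq_rel X S"
      using comp_closed uv D1 D2 unfolding pq_rel_def by blast
  qed
qed

lemma frac_eq_iff:
  assumes "x \<in> D" "f \<in> S" "y \<in> D" "g \<in> S"
  shows "frac x f = frac y g \<longleftrightarrow> ((x, f), (y, g)) \<in> pq_rel X S"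
  using assms by (simp add: pq_class_def eq_equiv_class_iff[OF equiv_pq_rel])

lemma frac_eqI:
  assumes "x \<in> D" "f \<in> S" "y \<in> D" "g \<in> S" "p \<in> S" "q \<in> S" "p \<star> g = q \<star> f" "p y = q x"
  shows "frac x f = frac y g"
  using assms unfolding frac_eq_iff[OF assms(1-4)] pq_rel_def by blast

lemma frac_eqD:
  assumes "frac x f = frac y g" "x \<in> D" "f \<in> S" "y \<in> D" "g \<in> S"
    "p \<in> S" "q \<in> S" "p \<star> g = q \<star> f"
  shows "p y = q x"
  using assms pq_rel_common_multiple frac_eq_iff by blast

lemma frac_in_pq_space: "x \<in> D \<Longrightarrow> f \<in> S \<Longrightarrow> frac x f \<in> pq_space X S"
  by (auto simp: pq_space_def pq_class_def quotient_def)

lemma pq_space_cases: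
  assumes "c \<in> pq_space X S"
  obtains x f where "x \<in> D" "f \<in> S" "c = frac x f"
  using assms by (auto simp: pq_space_def pq_class_def quotient_def)

section \<open>The bijection extending a map of the semigroup\<close>

text \<open>Right to left, the extension of \<open>g\<close> is well defined, in both the
  representative and the Ore pair; left to right, it is injective. With
  \<open>u \<star> p = v \<star> f'\<close>, each side amounts to
  \<open>u (q y) = v (g' x)\<close>.\<close>

lemma extension_eq_iff:
  assumes D: "x \<in> D" "y \<in> D" and S: "f \<in> S" "h \<in> S" "g \<in> S"
    and S': "f' \<in> S" "g' \<in> S" "p \<in> S" "q \<in> S"
    and eq: "f' \<star> g = g' \<star> f" "p \<star> g = q \<star> h"
  shows "frac (g' x) f' = frac (q y) p \<longleftrightarrow> frac x f = frac y h"
proof -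
  obtain u v where uv: "u \<in> S" "v \<in> S" "u \<star> p = v \<star> f'"
    using Ore[OF S'(1) S'(3)] by blast
  have common: "(u \<star> q) \<star> h = (v \<star> g') \<star> f"
    using comp_eq_trans[OF uv(3) eq(2,1)] S by blast
  show ?thesis
  proof
    assume "frac (g' x) f' = frac (q y) p"
    then have "u (q y) = v (g' x)"
      using frac_eqD uv S' D maps_to by blast
    then show "frac x f = frac y h"
      using frac_eqI[OF D(1) S(1) D(2) S(2) _ _ common] comp_closed uv S' D
      by (simp add: compose_eq)
  next
    assume "frac x f = frac y h"
    then have "(u \<star> q) y = (v \<star> g') x"
      using frac_eqD[OF _ D(1) S(1) D(2) S(2) _ _ common] comp_closed uv S' by simp
    then show "frac (g' x) f' = frac (q y) p"
      using frac_eqI[OF _ S'(1) _ S'(3) uv] maps_to D S' by (simp add: compose_eq)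
  qed
qed

lemma pq_extend_frac:
  assumes "x \<in> D" "f \<in> S" "g \<in> S" "f' \<in> S" "g' \<in> S" "f' \<star> g = g' \<star> f"
  shows "pq_extend X S g (frac x f) = frac (g' x) f'"
proof -
  have "(THE d. \<exists>y\<in>D. \<exists>h\<in>S. \<exists>p\<in>S. \<exists>q\<in>S.
      frac x f = frac y h \<and> p \<star> g = q \<star> h \<and> d = frac (q y) p) = frac (g' x) f'"
  proof (rule the_equality)
    fix d
    assume "\<exists>y\<in>D. \<exists>h\<in>S. \<exists>p\<in>S. \<exists>q\<in>S.
      frac x f = frac y h \<and> p \<star> g = q \<star> h \<and> d = frac (q y) p"
    then show "d = frac (g' x) f'"
      using extension_eq_iff[OF assms(1) _ assms(2) _ assms(3-5) _ _ assms(6)] by blast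
  qed (use assms in blast)
  then show ?thesis
    using frac_in_pq_space assms by (simp add: pq_extend_def)
qed

text \<open>Formally, applying \<open>g\<close> cancels the inverse of \<open>g\<close> in the
  inverse of \<open>f \<star> g\<close>. This yields surjectivity and an explicit formula for the
  inverse of the extension.\<close>

lemma pq_extend_frac_comp:
  assumes "x \<in> D" "f \<in> S" "g \<in> S"
  shows "pq_extend X S g (frac x (f \<star> g)) = frac x f"
proof -
  have "pq_extend X S g (frac x (f \<star> g)) = frac (f x) (f \<star> f)"
    using pq_extend_frac[of x "f \<star> g" g "f \<star> f" f] assms comp_closed assoc by simp
  also have "\<dots> = frac x f"
    using frac_eqI[of "f x" "f \<star> f" x f "f \<star> f" f] assms comp_closed assoc maps_to
    by (simp add: compose_eq)
  finally show ?thesis .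
qed

lemma bij_betw_pq_extend:
  assumes g: "g \<in> S"
  shows "bij_betw (pq_extend X S g) (pq_space X S) (pq_space X S)"
  unfolding bij_betw_def
proof
  show "inj_on (pq_extend X S g) (pq_space X S)"
  proof (rule inj_onI, elim pq_space_cases)
    fix c d x f y h
    assume eq: "pq_extend X S g c = pq_extend X S g d"
      and c: "x \<in> D" "f \<in> S" "c = frac x f" and d: "y \<in> D" "h \<in> S" "d = frac y h"
    obtain f' g' where 1: "f' \<in> S" "g' \<in> S" "f' \<star> g = g' \<star> f"
      using Ore[OF c(2) g] by blast
    obtain p q where 2: "p \<in> S" "q \<in> S" "p \<star> g = q \<star> h"
      using Ore[OF d(2) g] by blast
    show "c = d"
      using eq extension_eq_iff[of x y f h g f' g' p q] pq_extend_frac c d 1 2 g by simp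
  qed
  show "pq_extend X S g ` pq_space X S = pq_space X S"
  proof (intro equalityI subsetI)
    fix d assume "d \<in> pq_extend X S g ` pq_space X S"
    then obtain x f where x: "x \<in> D" "f \<in> S" "d = pq_extend X S g (frac x f)"
      by (auto elim: pq_space_cases)
    obtain f' g' where "f' \<in> S" "g' \<in> S" "f' \<star> g = g' \<star> f"
      using Ore[OF x(2) g] by blast
    then show "d \<in> pq_space X S"
      using x pq_extend_frac g frac_in_pq_space maps_to by simp
  next
    fix d assume "d \<in> pq_space X S"
    then show "d \<in> pq_extend X S g ` pq_space X S"
      using pq_extend_frac_comp comp_closed g frac_in_pq_space
      by (elim pq_space_cases) (metis imageI)
  qed
qed

section \<open>Continuity on the space of pseudoquotients\<close>

text \<open>The new denominator \<open>k\<close> may depend on \<open>f\<close> but not on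
  \<open>x\<close>, so each slice is sent continuously into a single slice; the universal property
  of the quotient map does the rest.\<close>

lemma continuous_map_pq_topology:
  assumes "\<And>f. f \<in> S \<Longrightarrow>
    \<exists>k\<in>S. \<exists>h. continuous_map X X h \<and> (\<forall>x\<in>D. \<phi> (frac x f) = frac (h x) k)"
  shows "continuous_map (pq_topology X S) (pq_topology X S) \<phi>"
proof -
  let ?P = "prod_topology X (discrete_topology S)"
  have quot: "quotient_map ?P (pq_topology X S) (\<lambda>(x, f). frac x f)"
    unfolding pq_topology_def by (rule quotient_map_quotient_topology)
  have "continuous_map X (pq_topology X S) (\<lambda>x. \<phi> (frac x f))" if f: "f \<in> S" for f
  proof -
    obtain h k where hk: "continuous_map X X h" "k \<in> S"
      "\<And>x. x \<in> D \<Longrightarrow> \<phi> (frac x f) = frac (h x) k"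
      using assms[OF f] by blast
    have "continuous_map X ?P (\<lambda>x. (h x, k))"
      using hk by (simp add: continuous_map_paired)
    then have "continuous_map X (pq_topology X S) ((\<lambda>(x, f). frac x f) \<circ> (\<lambda>x. (h x, k)))"
      using continuous_map_compose quotient_imp_continuous_map[OF quot] by blast
    then show ?thesis
      by (rule continuous_map_eq) (simp add: hk)
  qed
  then have "continuous_map ?P (pq_topology X S) (\<phi> \<circ> (\<lambda>(x, f). frac x f))"
    by (intro continuous_map_from_prod_discrete) simp
  then show ?thesis
    by (rule continuous_compose_quotient_map[OF quot])
qed

lemma homeomorphic_map_pq_extend:
  assumes g: "g \<in> S"
  shows "homeomorphic_map (pq_topology X S) (pq_topology X S) (pq_extend X S g)"
proof -
  let ?e = "pq_extend X S g" and ?i = "inv_into (pq_space X S) (pq_extend X S g)"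
  have "continuous_map (pq_topology X S) (pq_topology X S) ?e"
  proof (rule continuous_map_pq_topology)
    fix f assume f: "f \<in> S"
    \<comment> \<open>The Ore pair depends on \<open>f\<close> and \<open>g\<close> alone, so
      \<open>k = f'\<close> and \<open>h = g'\<close> serve all \<open>x\<close> at once.\<close>
    obtain f' g' where "f' \<in> S" "g' \<in> S" "f' \<star> g = g' \<star> f"
      using Ore[OF f g] by blast
    then show "\<exists>k\<in>S. \<exists>h. continuous_map X X h \<and> (\<forall>x\<in>D. ?e (frac x f) = frac (h x) k)"
      using pq_extend_frac f g continuous by blast
  qed
  moreover have "continuous_map (pq_topology X S) (pq_topology X S) ?i"
  proof (rule continuous_map_pq_topology)
    fix f assume f: "f \<in> S"
    have "?i (frac x f) = frac x (f \<star> g)" if "x \<in> D" for x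
      using that f g pq_extend_frac_comp comp_closed frac_in_pq_space
        inv_into_f_eq[OF bij_betw_imp_inj_on[OF bij_betw_pq_extend[OF g]]] by simp
    then show "\<exists>k\<in>S. \<exists>h. continuous_map X X h \<and> (\<forall>x\<in>D. ?i (frac x f) = frac (h x) k)"
      using comp_closed[OF f g] by (intro bexI[of _ "f \<star> g"] exI[of _ id]) simp_all
  qed
  ultimately have "homeomorphic_maps (pq_topology X S) (pq_topology X S) ?e ?i"
    using bij_betw_inv_into_left[OF bij_betw_pq_extend[OF g]]
      bij_betw_inv_into_right[OF bij_betw_pq_extend[OF g]]
    by (simp add: homeomorphic_maps_def topspace_pq_topology)
  then show ?thesis
    by (rule homeomorphic_maps_map[THEN iffD1, THEN conjunct1])
qed

text \<open>Besides bijectivity, \<open>Bij\<close> demands extensionality, which the restricted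
  abstraction in \<open>pq_extend_def\<close> supplies.\<close>

lemma pq_extend_in_carrier: "g \<in> S \<Longrightarrow> pq_extend X S g \<in> carrier (BijGroup (pq_space X S))"
  using bij_betw_pq_extend by (auto simp: BijGroup_def Bij_def pq_extend_def)

end

section \<open>Homeomorphisms in the group of bijections\<close>

text \<open>The group inverse is a restricted function, so it is compared with the topological
  inverse \<open>\<psi>\<close> on \<open>topspace T\<close> only, which suffices for
  \<open>homeomorphic_map\<close>.\<close>

lemma homeomorphic_map_BijGroup_inv:
  assumes "homeomorphic_map T T \<phi>" "\<phi> \<in> carrier (BijGroup (topspace T))"
  shows "homeomorphic_map T T (inv\<^bsub>BijGroup (topspace T)\<^esub> \<phi>)"
proof -
  have \<phi>: "\<phi> \<in> Bij (topspace T)"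
    using assms(2) by (simp add: BijGroup_def)
  obtain \<psi> where \<psi>: "homeomorphic_maps T T \<phi> \<psi>"
    using assms(1) homeomorphic_map_maps by blast
  have eq: "\<psi> y = (inv\<^bsub>BijGroup (topspace T)\<^esub> \<phi>) y" if "y \<in> topspace T" for y
  proof -
    have "\<psi> y \<in> topspace T" "\<phi> (\<psi> y) = y"
      using \<psi> that continuous_map_funspace by (auto simp: homeomorphic_maps_def)
    then show ?thesis
      using \<phi> that by (simp add: inv_BijGroup Bij_def bij_betw_def inv_into_f_eq)
  qed
  have "homeomorphic_map T T \<psi>"
    using \<psi> by (simp add: homeomorphic_maps_map)
  then show ?thesis
    using homeomorphic_map_eq eq by blast
qed

lemma homeomorphic_map_generate_BijGroup:
  assumes carrier: "H \<subseteq> carrier (BijGroup (topspace T))"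
    and homeo: "\<And>h. h \<in> H \<Longrightarrow> homeomorphic_map T T h"
    and "\<phi> \<in> generate (BijGroup (topspace T)) H"
  shows "homeomorphic_map T T \<phi>"
  using assms(3)
proof induction
  case one
  have "homeomorphic_map T T (\<lambda>x. x)"
    using homeomorphic_map_id[of T T] by (simp add: id_def)
  then show ?case
    by (rule homeomorphic_map_eq) (simp add: BijGroup_def)
next
  case (incl h)
  then show ?case by (rule homeo)
next
  case (inv h)
  then show ?case
    using homeomorphic_map_BijGroup_inv homeo carrier by blast
next
  case (eng h1 h2)
  \<comment> \<open>Multiplication in \<open>BijGroup\<close> is restricted to \<open>Bij\<close>,
    so membership is required before the product unfolds to a composition.\<close>
  have "h1 \<in> Bij (topspace T)" "h2 \<in> Bij (topspace T)"
    using group.generate_in_carrier[OF group_BijGroup carrier eng.hyps(1)]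
      group.generate_in_carrier[OF group_BijGroup carrier eng.hyps(2)]
    by (simp_all add: BijGroup_def)
  then have "(h1 \<circ> h2) x = (h1 \<otimes>\<^bsub>BijGroup (topspace T)\<^esub> h2) x" if "x \<in> topspace T" for x
    using that by (simp add: BijGroup_def compose_eq)
  moreover have "homeomorphic_map T T (h1 \<circ> h2)"
    using eng.IH homeomorphic_map_compose by blast
  ultimately show ?case
    by (rule homeomorphic_map_eq[rotated])
qed

theorem theorem4p2:
  fixes X :: "'a topology" and S :: "('a \<Rightarrow> 'a) set"
  assumes "topspace X \<noteq> {}"
    and "S \<noteq> {}"
    and "\<And>f. f \<in> S \<Longrightarrow> f \<in> extensional (topspace X)"
    and "\<And>f. f \<in> S \<Longrightarrow> continuous_map X X f"
    and "\<And>f. f \<in> S \<Longrightarrow> inj_on f (topspace X)"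
    and semigroup: "\<And>f g. f \<in> S \<Longrightarrow> g \<in> S \<Longrightarrow> compose (topspace X) f g \<in> S"
    and Ore: "\<And>f g. f \<in> S \<Longrightarrow> g \<in> S \<Longrightarrow>
      \<exists>f'\<in>S. \<exists>g'\<in>S. compose (topspace X) f' g = compose (topspace X) g' f"
    and right_cancel: "\<And>f1 f2 g. f1 \<in> S \<Longrightarrow> f2 \<in> S \<Longrightarrow> g \<in> S \<Longrightarrow>
      compose (topspace X) f1 g = compose (topspace X) f2 g \<Longrightarrow> f1 = f2"
  shows "\<forall>\<phi>\<in>pq_group X S. homeomorphic_map (pq_topology X S) (pq_topology X S) \<phi>"
proof -
  interpret pseudoquotients X S
    using assms by unfold_locales
  show ?thesis
    using homeomorphic_map_generate_BijGroup[of "pq_extend X S ` S" "pq_topology X S"]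
      pq_extend_in_carrier homeomorphic_map_pq_extend
    unfolding pq_group_def topspace_pq_topology by blast
qed

end
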